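(* Let $T>0$, let $p\ge2$ be an even integer, let $q\in[1,\infty]$ with conjugate exponent $q'=q/(q-1)$ (so $q'=\infty$ if $q=1$, $q'=1$ if $q=\infty$), and let $\pi=(\pi_n)_{n\ge1}$ be a sequence of partitions of $[0,T]$. Let $f\in C^{p-1}(\mathbb R,\mathbb R)$ and assume that $f^{(p-1)}$ is weakly differentiable with derivative $f^{(p)}\in L^{q'}(\mathbb R)$. Then for any $S\in\mathcal L^q_p(\pi)$, with associated local time $L$, and any $t\in[0,T]$, the pointwise limit of compensated Riemann sums $$\int_0^tf'(S(s))\,dS(s):=\lim_{n\to\infty}\sum_{[t_j,t_{j+1}]\in\pi_n}\sum_{k=1}^{p-1}\frac{f^{(k)}(S(t_j))}{k!}\bigl(S(t_{j+1}\wedge t)-S(t_j\wedge t)\bigr)^k$$ exists and the following change of variable formula holds: $$f(S(t))-f(S(0))=\int_0^tf'(S(s))\,dS(s)+\frac1{(p-1)!}\int_{\mathbb R}f^{(p)}(x)L_t(x)\,dx.$$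
   Context: Each partition $\pi_n=\{0=t^n_0<t^n_1<\dots<t^n_{N(\pi_n)}=T\}$ is finite; $[t_j,t_{j+1}]\in\pi_n$ means that $t_j<t_{j+1}$ are consecutive points of $\pi_n$. $\operatorname{osc}(S,\pi_n):=\max_{[t_j,t_{j+1}]\in\pi_n}\max_{r,s\in[t_j,t_{j+1}]}|S(s)-S(r)|$. For $a,b\in\mathbb R$ write $I(a,b):=(a,b]$ if $b\ge a$ and $I(a,b):=(b,a]$ if $b<a$. Local time: let $p$ be an even integer and $q\in[1,\infty]$. A path $S\in C([0,T],\mathbb R)$ has an $L^q$-local time of order $p-1$ along $\pi=(\pi_n)$, written $S\in\mathcal L^q_p(\pi)$, if $\operatorname{osc}(S,\pi_n)\to0$ and, for every $t\in[0,T]$, $$L^{\pi_n,p-1}_t(\cdot)=\sum_{[t_j,t_{j+1}]\in\pi_n}\mathbf 1_{I(S(t_j\wedge t),S(t_{j+1}\wedge t))}(\cdot)\,|S(t_{j+1}\wedge t)-\cdot|^{p-1}$$ converges weakly in $L^q(\mathbb R)$ as $n\to\infty$ to $L_t$, where $L:[0,T]\to L^q(\mathbb R)$, $t\mapsto L_t$, is weakly continuous. $L$ is called the local time of $S$. *)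

theory Defs
  imports "HOL-Analysis.Analysis" "HOL-Probability.Essential_Supremum"
begin

section \<open>Lebesgue spaces on the real line\<close>

text \<open>Elements of \<open>L\<^sup>q\<close> are represented by Lebesgue measurable functions.\<close>

definition Lq_space :: "ennreal \<Rightarrow> (real \<Rightarrow> real) set" where
  "Lq_space q = {g \<in> borel_measurable lebesgue.
     if q = \<infinity> then esssup lebesgue (\<lambda>x. ennreal \<bar>g x\<bar>) < \<infinity>
     else integrable lebesgue (\<lambda>x. \<bar>g x\<bar> powr enn2real q)}"

definition Lq_norm :: "ennreal \<Rightarrow> (real \<Rightarrow> real) \<Rightarrow> real" where
  "Lq_norm q g =
     (if q = \<infinity> then enn2real (esssup lebesgue (\<lambda>x. ennreal \<bar>g x\<bar>))
      else (\<integral>x. \<bar>g x\<bar> powr enn2real q \<partial>lebesgue) powr (1 / enn2real q))"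

definition conjugate_exponent :: "ennreal \<Rightarrow> ennreal" where
  "conjugate_exponent q = (if q = 1 then \<infinity> else if q = \<infinity> then 1 else q / (q - 1))"

text \<open>The continuous linear functionals on \<open>L\<^sup>q\<close>. Boundedness forces
  \<open>\<phi> g = \<phi> h\<close> whenever \<open>g\<close> and \<open>h\<close> agree almost everywhere, so these are functionals on
  equivalence classes; the values of \<open>\<phi>\<close> outside \<open>Lq_space q\<close> are irrelevant.\<close>

definition Lq_dual :: "ennreal \<Rightarrow> ((real \<Rightarrow> real) \<Rightarrow> real) set" where
  "Lq_dual q = {\<phi>.
     (\<forall>g\<in>Lq_space q. \<forall>h\<in>Lq_space q. \<phi> (\<lambda>x. g x + h x) = \<phi> g + \<phi> h) \<and>
     (\<forall>g\<in>Lq_space q. \<forall>c. \<phi> (\<lambda>x. c * g x) = c * \<phi> g) \<and>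
     (\<exists>C. \<forall>g\<in>Lq_space q. \<bar>\<phi> g\<bar> \<le> C * Lq_norm q g)}"

definition Lq_weakly_converges :: "ennreal \<Rightarrow> (nat \<Rightarrow> real \<Rightarrow> real) \<Rightarrow> (real \<Rightarrow> real) \<Rightarrow> bool" where
  "Lq_weakly_converges q g h \<longleftrightarrow>
     (\<forall>n. g n \<in> Lq_space q) \<and> h \<in> Lq_space q \<and>
     (\<forall>\<phi>\<in>Lq_dual q. (\<lambda>n. \<phi> (g n)) \<longlonglongrightarrow> \<phi> h)"

definition Lq_weakly_continuous_on :: "ennreal \<Rightarrow> real set \<Rightarrow> (real \<Rightarrow> real \<Rightarrow> real) \<Rightarrow> bool" where
  "Lq_weakly_continuous_on q A L \<longleftrightarrow>
     (\<forall>t\<in>A. L t \<in> Lq_space q) \<and> (\<forall>\<phi>\<in>Lq_dual q. continuous_on A (\<lambda>t. \<phi> (L t)))"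


section \<open>Differentiability\<close>

definition Ck :: "nat \<Rightarrow> (real \<Rightarrow> real) \<Rightarrow> bool" where
  "Ck k f \<longleftrightarrow> (\<forall>i<k. \<forall>x. (deriv ^^ i) f differentiable (at x)) \<and>
     continuous_on UNIV ((deriv ^^ k) f)"

definition test_functions :: "(real \<Rightarrow> real) set" where
  "test_functions = {\<psi>. (\<forall>k. Ck k \<psi>) \<and> compact (closure {x. \<psi> x \<noteq> 0})}"

definition locally_integrable :: "(real \<Rightarrow> real) \<Rightarrow> bool" where
  "locally_integrable g \<longleftrightarrow> (\<forall>K. compact K \<longrightarrow> set_integrable lebesgue K g)"

definition has_weak_derivative :: "(real \<Rightarrow> real) \<Rightarrow> (real \<Rightarrow> real) \<Rightarrow> bool" where
  "has_weak_derivative h g \<longleftrightarrow> locally_integrable h \<and> locally_integrable g \<and>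
     (\<forall>\<psi>\<in>test_functions.
        (\<integral>x. h x * deriv \<psi> x \<partial>lebesgue) = - (\<integral>x. g x * \<psi> x \<partial>lebesgue))"


section \<open>Partitions and local time\<close>

text \<open>A partition is the strictly increasing list of its points, so its intervals are
  \<open>[P ! j, P ! Suc j]\<close> with \<open>j < length P - 1\<close>.\<close>

definition is_partition :: "real \<Rightarrow> real list \<Rightarrow> bool" where
  "is_partition T P \<longleftrightarrow> P \<noteq> [] \<and> sorted_wrt (<) P \<and> hd P = 0 \<and> last P = T"

text \<open>For continuous \<open>S\<close> the inner supremum is attained.\<close>

definition osc :: "(real \<Rightarrow> real) \<Rightarrow> real list \<Rightarrow> real" where
  "osc S P = Max ((\<lambda>j. SUP (r, s) \<in> {P ! j..P ! Suc j} \<times> {P ! j..P ! Suc j}. \<bar>S s - S r\<bar>)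
     ` {..<length P - 1})"

definition oriented_interval :: "real \<Rightarrow> real \<Rightarrow> real set" where
  "oriented_interval a b = (if b \<ge> a then {a<..b} else {b<..a})"

definition discrete_local_time ::
    "real list \<Rightarrow> nat \<Rightarrow> (real \<Rightarrow> real) \<Rightarrow> real \<Rightarrow> real \<Rightarrow> real" where
  "discrete_local_time P m S t x =
     (\<Sum>j<length P - 1.
        indicator (oriented_interval (S (min (P ! j) t)) (S (min (P ! Suc j) t))) x
        * \<bar>S (min (P ! Suc j) t) - x\<bar> ^ m)"

text \<open>\<open>has_local_time T \<pi> q p S L\<close>: the path \<open>S\<close> has \<open>L\<close> as \<open>L\<^sup>q\<close>-local time of order
  \<open>p - 1\<close> along \<open>\<pi>\<close>.\<close>

definition has_local_time ::
    "real \<Rightarrow> (nat \<Rightarrow> real list) \<Rightarrow> ennreal \<Rightarrow> nat \<Rightarrow> (real \<Rightarrow> real) \<Rightarrow> (real \<Rightarrow> real \<Rightarrow> real) \<Rightarrow> bool" where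
  "has_local_time T \<pi> q p S L \<longleftrightarrow>
     continuous_on {0..T} S \<and>
     (\<lambda>n. osc S (\<pi> n)) \<longlonglongrightarrow> 0 \<and>
     (\<forall>t\<in>{0..T}. Lq_weakly_converges q (\<lambda>n. discrete_local_time (\<pi> n) (p - 1) S t) (L t)) \<and>
     Lq_weakly_continuous_on q {0..T} L"


section \<open>Compensated Riemann sums\<close>

definition compensated_sum ::
    "real list \<Rightarrow> nat \<Rightarrow> (real \<Rightarrow> real) \<Rightarrow> (real \<Rightarrow> real) \<Rightarrow> real \<Rightarrow> real" where
  "compensated_sum P p f S t =
     (\<Sum>j<length P - 1. \<Sum>k=1..p - 1.
        (deriv ^^ k) f (S (P ! j)) / fact k * (S (min (P ! Suc j) t) - S (min (P ! j) t)) ^ k)"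

definition pathwise_integral ::
    "(nat \<Rightarrow> real list) \<Rightarrow> nat \<Rightarrow> (real \<Rightarrow> real) \<Rightarrow> (real \<Rightarrow> real) \<Rightarrow> real \<Rightarrow> real" where
  "pathwise_integral \<pi> p f S t = lim (\<lambda>n. compensated_sum (\<pi> n) p f S t)"

end

theory Submission
  imports Defs
begin

text \<open>Testing the weak derivative against \<open>w \<chi>\<^sub>n\<close>, where \<open>w\<close> is a polynomial and \<open>\<chi>\<^sub>n\<close> are smooth
  cutoffs tending pointwise to the indicator of \<open>(a, b]\<close>, gives integration by parts on \<open>(a, b]\<close>,
  hence Taylor's formula of order \<open>p - 1\<close> with integral remainder. Since \<open>p - 1\<close> is odd, the
  remainder between two consecutive values of \<open>S\<close> is, whichever is larger, the integral of the
  weak derivative against the corresponding summand of the discrete local time. Summing over the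
  partition expresses the compensated sum through the pairing of \<open>fp\<close> with the discrete local time, which by Hoelder's
  inequality is a continuous linear functional on \<open>L\<^sup>q\<close>, so weak convergence passes to the limit.\<close>

section \<open>Hoelder's inequality\<close>

text \<open>Young's inequality is applied pointwise to \<open>f\<close> and \<open>g\<close> after
  division by their norms. The unnormalised version already dominates the product and gives
  integrability.\<close>

lemma Hoelder_integral:
  fixes f g :: "'a \<Rightarrow> real" and P Q :: real
  assumes PQ: "P > 1" "Q > 1" "1 / P + 1 / Q = 1"
    and [measurable]: "f \<in> borel_measurable M" "g \<in> borel_measurable M"
    and f: "integrable M (\<lambda>x. \<bar>f x\<bar> powr P)" and g: "integrable M (\<lambda>x. \<bar>g x\<bar> powr Q)"
  shows "integrable M (\<lambda>x. f x * g x)"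
    and "\<bar>\<integral>x. f x * g x \<partial>M\<bar>
      \<le> (\<integral>x. \<bar>f x\<bar> powr P \<partial>M) powr (1 / P) * (\<integral>x. \<bar>g x\<bar> powr Q \<partial>M) powr (1 / Q)"
proof -
  define A where "A = (\<integral>x. \<bar>f x\<bar> powr P \<partial>M)"
  define B where "B = (\<integral>x. \<bar>g x\<bar> powr Q \<partial>M)"
  have young: "a * b \<le> a powr P / P + b powr Q / Q" if "a \<ge> 0" "b \<ge> 0" for a b :: real
    using Youngs_inequality[of P Q a b] PQ that by simp
  show fg: "integrable M (\<lambda>x. f x * g x)"
  proof (rule Bochner_Integration.integrable_bound)
    show "integrable M (\<lambda>x. \<bar>f x\<bar> powr P / P + \<bar>g x\<bar> powr Q / Q)"
      using f g by simp
    show "AE x in M. norm (f x * g x) \<le> norm (\<bar>f x\<bar> powr P / P + \<bar>g x\<bar> powr Q / Q)"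
      using young PQ by (intro AE_I2) (simp add: abs_mult order.trans[OF _ abs_ge_self])
  qed simp
  have "A \<ge> 0" "B \<ge> 0"
    unfolding A_def B_def by simp_all
  have "\<bar>\<integral>x. f x * g x \<partial>M\<bar> \<le> A powr (1 / P) * B powr (1 / Q)"
  proof (cases "A = 0 \<or> B = 0")
    case True
    \<comment> \<open>Normalisation is impossible here, but a vanishing norm forces one factor to be
      zero almost everywhere.\<close>
    then have "AE x in M. f x * g x = 0"
      using integral_nonneg_eq_0_iff_AE[OF f] integral_nonneg_eq_0_iff_AE[OF g]
      by (auto simp: A_def B_def elim: eventually_mono)
    then have "(\<integral>x. f x * g x \<partial>M) = 0"
      by (rule integral_eq_zero_AE)
    then show ?thesis by simp
  next
    case False
    with \<open>A \<ge> 0\<close> \<open>B \<ge> 0\<close> have "A > 0" "B > 0" by auto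
    \<comment> \<open>\<open>c\<close> is the product of the two norms. After normalisation the
      right-hand side of Young's inequality integrates to \<open>1 / P + 1 / Q\<close>, which is 1,
      so \<open>c\<close> itself is the final bound.\<close>
    define c where "c = A powr (1 / P) * B powr (1 / Q)"
    have "c > 0" using \<open>A > 0\<close> \<open>B > 0\<close> by (simp add: c_def)
    have pw: "\<bar>f x * g x\<bar> \<le> c * (\<bar>f x\<bar> powr P / (A * P) + \<bar>g x\<bar> powr Q / (B * Q))" for x
    proof -
      have "\<bar>f x * g x\<bar> = c * (\<bar>f x\<bar> / A powr (1 / P) * (\<bar>g x\<bar> / B powr (1 / Q)))"
        using \<open>A > 0\<close> \<open>B > 0\<close> by (simp add: c_def abs_mult)
      also have "\<dots> \<le> c * ((\<bar>f x\<bar> / A powr (1 / P)) powr P / P + (\<bar>g x\<bar> / B powr (1 / Q)) powr Q / Q)"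
        using \<open>c > 0\<close> by (intro mult_left_mono young) auto
      also have "\<dots> = c * (\<bar>f x\<bar> powr P / (A * P) + \<bar>g x\<bar> powr Q / (B * Q))"
        using PQ \<open>A > 0\<close> \<open>B > 0\<close> by (simp add: powr_divide powr_powr)
      finally show ?thesis .
    qed
    have "\<bar>\<integral>x. f x * g x \<partial>M\<bar> \<le> (\<integral>x. \<bar>f x * g x\<bar> \<partial>M)"
      by (rule integral_abs_bound)
    also have "\<dots> \<le> (\<integral>x. c * (\<bar>f x\<bar> powr P / (A * P) + \<bar>g x\<bar> powr Q / (B * Q)) \<partial>M)"
      using fg f g pw by (intro integral_mono) auto
    also have "\<dots> = c * (A / (A * P) + B / (B * Q))"
      using f g by (simp add: A_def B_def)
    also have "\<dots> = c"
      using PQ \<open>A > 0\<close> \<open>B > 0\<close> by simp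
    finally show ?thesis by (simp add: c_def)
  qed
  then show "\<bar>\<integral>x. f x * g x \<partial>M\<bar>
      \<le> (\<integral>x. \<bar>f x\<bar> powr P \<partial>M) powr (1 / P) * (\<integral>x. \<bar>g x\<bar> powr Q \<partial>M) powr (1 / Q)"
    by (simp add: A_def B_def)
qed

section \<open>The pairing of conjugate Lebesgue spaces\<close>

lemma AE_le_Lq_norm_infinity:
  assumes "g \<in> Lq_space \<infinity>"
  shows "AE x in lebesgue. \<bar>g x\<bar> \<le> Lq_norm \<infinity> g"
proof -
  \<comment> \<open>\<open>enn2real\<close> sends infinity to 0, so finiteness is what makes the
    norm a genuine upper bound.\<close>
  have fin: "esssup lebesgue (\<lambda>x. ennreal \<bar>g x\<bar>) < \<infinity>"
    using assms by (simp add: Lq_space_def)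
  have "AE x in lebesgue. ennreal \<bar>g x\<bar> \<le> esssup lebesgue (\<lambda>x. ennreal \<bar>g x\<bar>)"
    by (rule esssup_AE)
  then show ?thesis
    by eventually_elim (use fin enn2real_mono in \<open>fastforce simp: Lq_norm_def\<close>)
qed

lemma Hoelder_one_infinity:
  assumes f: "f \<in> Lq_space 1" and g: "g \<in> Lq_space \<infinity>"
  shows "integrable lebesgue (\<lambda>x. f x * g x)"
    and "\<bar>\<integral>x. f x * g x \<partial>lebesgue\<bar> \<le> Lq_norm 1 f * Lq_norm \<infinity> g"
proof -
  have [measurable]: "f \<in> borel_measurable lebesgue" "g \<in> borel_measurable lebesgue"
    and f1: "integrable lebesgue (\<lambda>x. \<bar>f x\<bar>)"
    using f g by (auto simp: Lq_space_def)
  have bound: "AE x in lebesgue. \<bar>f x * g x\<bar> \<le> \<bar>f x\<bar> * Lq_norm \<infinity> g"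
    using AE_le_Lq_norm_infinity[OF g]
    by eventually_elim (simp add: abs_mult mult_left_mono)
  show fg: "integrable lebesgue (\<lambda>x. f x * g x)"
    by (rule Bochner_Integration.integrable_bound[of _ "\<lambda>x. \<bar>f x\<bar> * Lq_norm \<infinity> g"])
      (use f1 bound in \<open>auto elim!: eventually_mono intro: order.trans[OF _ abs_ge_self]\<close>)
  have "\<bar>\<integral>x. f x * g x \<partial>lebesgue\<bar> \<le> (\<integral>x. \<bar>f x * g x\<bar> \<partial>lebesgue)"
    by (rule integral_abs_bound)
  also have "\<dots> \<le> (\<integral>x. \<bar>f x\<bar> * Lq_norm \<infinity> g \<partial>lebesgue)"
    using fg f1 bound by (intro integral_mono_AE) auto
  also have "\<dots> = Lq_norm 1 f * Lq_norm \<infinity> g"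
    by (simp add: Lq_norm_def)
  finally show "\<bar>\<integral>x. f x * g x \<partial>lebesgue\<bar> \<le> Lq_norm 1 f * Lq_norm \<infinity> g" .
qed

text \<open>For \<open>q = ennreal r\<close> with \<open>r > 1\<close>, subtraction and division in
  \<open>ennreal\<close> agree with the real operations, so the real-exponent version of Hoelder's
  inequality applies.\<close>

lemma enn2real_conjugate_exponent:
  assumes "1 < q" "q < \<infinity>"
  shows "conjugate_exponent q \<noteq> \<infinity>"
    and "enn2real (conjugate_exponent q) = enn2real q / (enn2real q - 1)"
    and "enn2real q > 1"
proof -
  obtain r where r: "q = ennreal r" "r \<ge> 0"
    using assms by (cases q) auto
  with assms have "r > 1" by simp
  have "q / (q - 1) = ennreal (r / (r - 1))"
    using r \<open>r > 1\<close> by (simp add: ennreal_minus divide_ennreal flip: ennreal_1)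
  with assms r \<open>r > 1\<close> show "conjugate_exponent q \<noteq> \<infinity>"
    and "enn2real (conjugate_exponent q) = enn2real q / (enn2real q - 1)"
    and "enn2real q > 1"
    by (auto simp: conjugate_exponent_def)
qed

theorem Hoelder_Lq:
  assumes q: "q \<ge> 1" and f: "f \<in> Lq_space (conjugate_exponent q)" and g: "g \<in> Lq_space q"
  shows "integrable lebesgue (\<lambda>x. f x * g x)"
    and "\<bar>\<integral>x. f x * g x \<partial>lebesgue\<bar> \<le> Lq_norm (conjugate_exponent q) f * Lq_norm q g"
proof -
  consider "q = 1" | "q = \<infinity>" | "1 < q" "q < \<infinity>"
    using q by (auto simp: less_top[symmetric] order_le_less)
  then have "integrable lebesgue (\<lambda>x. f x * g x) \<and>
    \<bar>\<integral>x. f x * g x \<partial>lebesgue\<bar> \<le> Lq_norm (conjugate_exponent q) f * Lq_norm q g"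
  proof cases
    case 1
    \<comment> \<open>Now \<open>f\<close> is the essentially bounded factor, so the endpoint lemma
      is used with its two functions exchanged.\<close>
    then show ?thesis
      using Hoelder_one_infinity[of g f] f g by (simp add: conjugate_exponent_def mult.commute)
  next
    case 2
    then show ?thesis
      using Hoelder_one_infinity[of f g] f g by (simp add: conjugate_exponent_def)
  next
    case 3
    note conj = enn2real_conjugate_exponent[OF 3]
    define Q where "Q = enn2real q"
    define P where "P = enn2real (conjugate_exponent q)"
    have "Q > 1" "P = Q / (Q - 1)"
      using conj by (auto simp: P_def Q_def)
    then have PQ: "P > 1" "1 / P + 1 / Q = 1"
      by (simp_all flip: add_divide_distrib)
    show ?thesis
      using Hoelder_integral[OF PQ(1) \<open>Q > 1\<close> PQ(2), of f lebesgue g] f g conj 3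
      by (auto simp: Lq_space_def Lq_norm_def P_def Q_def)
  qed
  then show "integrable lebesgue (\<lambda>x. f x * g x)"
    and "\<bar>\<integral>x. f x * g x \<partial>lebesgue\<bar> \<le> Lq_norm (conjugate_exponent q) f * Lq_norm q g"
    by auto
qed

text \<open>Hoelder's inequality serves twice: integrability of the products gives additivity, and
  the norm bound gives continuity with constant
  \<open>Lq_norm (conjugate_exponent q) f\<close>.\<close>

lemma integral_pairing_in_Lq_dual:
  assumes "q \<ge> 1" "f \<in> Lq_space (conjugate_exponent q)"
  shows "(\<lambda>g. \<integral>x. f x * g x \<partial>lebesgue) \<in> Lq_dual q"
  using Hoelder_Lq[OF assms] unfolding Lq_dual_def
  by (auto simp: distrib_left mult.left_commute)

section \<open>Smooth cutoffs\<close>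

text \<open>The polynomial parameter keeps the family closed under differentiation: differentiating
  \<open>exp (- (1 / x))\<close> and \<open>poly P (1 / x)\<close> only produces further polynomials
  in \<open>1 / x\<close>.\<close>

definition flat :: "real poly \<Rightarrow> real \<Rightarrow> real" where
  "flat P x = (if x > 0 then poly P (1 / x) * exp (- (1 / x)) else 0)"

lemma tendsto_poly_times_exp_neg: "((\<lambda>x::real. poly P x * exp (- x)) \<longlongrightarrow> 0) at_top"
proof -
  have "((\<lambda>x::real. \<Sum>i\<le>degree P. coeff P i * (x ^ i / exp x)) \<longlongrightarrow> (\<Sum>i\<le>degree P. coeff P i * 0)) at_top"
    by (intro tendsto_sum tendsto_mult tendsto_const tendsto_power_div_exp_0)
  then show ?thesis
    by (simp add: poly_altdef exp_minus divide_inverse sum_distrib_right mult.assoc)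
qed

lemma flat_tendsto_0_at_right: "(flat P \<longlongrightarrow> 0) (at_right 0)"
proof -
  have "((\<lambda>x::real. poly P (inverse x) * exp (- inverse x)) \<longlongrightarrow> 0) (at_right 0)"
    by (rule filterlim_compose[OF tendsto_poly_times_exp_neg filterlim_inverse_at_top_right])
  moreover have "\<forall>\<^sub>F x in at_right 0. poly P (inverse x) * exp (- inverse x) = flat P x"
    using eventually_at_right_less by eventually_elim (simp add: flat_def inverse_eq_divide)
  ultimately show ?thesis
    by (rule Lim_transform_eventually)
qed

lemma DERIV_flat: "(flat P has_real_derivative flat ([:0, 0, 1:] * (P - pderiv P)) x) (at x)"
proof -
  consider "x > 0" | "x < 0" | "x = 0" by linarith
  then show ?thesis
  proof cases
    case 1
    have "((\<lambda>x. poly P (1 / x) * exp (- (1 / x))) has_real_derivative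
        flat ([:0, 0, 1:] * (P - pderiv P)) x) (at x)"
      using 1 by (auto intro!: derivative_eq_intros DERIV_chain2[of "poly P"] poly_DERIV
          simp: flat_def field_simps)
    then show ?thesis
      by (rule has_field_derivative_transform_within_open[where S = "{0<..}"])
        (use 1 in \<open>auto simp: flat_def\<close>)
  next
    case 2
    have "((\<lambda>_. 0) has_real_derivative flat ([:0, 0, 1:] * (P - pderiv P)) x) (at x)"
      using 2 by (simp add: flat_def)
    then show ?thesis
      by (rule has_field_derivative_transform_within_open[where S = "{..<0}"])
        (use 2 in \<open>auto simp: flat_def\<close>)
  next
    case 3
    \<comment> \<open>The factor \<open>1 / y\<close> of the difference quotient is absorbed into
      the polynomial as \<open>[:0, 1:]\<close>. The quotient is thus again a flat function and
      tends to 0 from the right.\<close>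
    have "\<forall>\<^sub>F y in at_right 0. flat ([:0, 1:] * P) y = (flat P y - flat P 0) / (y - 0)"
      using eventually_at_right_less by eventually_elim (simp add: flat_def)
    then have right: "((\<lambda>y. (flat P y - flat P 0) / (y - 0)) \<longlongrightarrow> 0) (at_right 0)"
      by (rule Lim_transform_eventually[OF flat_tendsto_0_at_right])
    have "\<forall>\<^sub>F y in at_left 0. 0 = (flat P y - flat P 0) / (y - 0)"
      unfolding eventually_at_left_field by (intro exI[of _ "-1"]) (simp add: flat_def)
    then have left: "((\<lambda>y. (flat P y - flat P 0) / (y - 0)) \<longlongrightarrow> 0) (at_left 0)"
      by (rule Lim_transform_eventually[OF tendsto_const])
    show ?thesis
      using filterlim_split_at[OF left right] 3
      by (simp add: has_field_derivative_iff flat_def)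
  qed
qed

text \<open>A class of functions closed under differentiation, large enough to contain the cutoffs
  and polynomials needed below.\<close>

inductive_set elementary_smooth :: "(real \<Rightarrow> real) set" where
  const: "(\<lambda>_. c) \<in> elementary_smooth"
| ident: "(\<lambda>x. x) \<in> elementary_smooth"
| add: "u \<in> elementary_smooth \<Longrightarrow> v \<in> elementary_smooth \<Longrightarrow> (\<lambda>x. u x + v x) \<in> elementary_smooth"
| mult: "u \<in> elementary_smooth \<Longrightarrow> v \<in> elementary_smooth \<Longrightarrow> (\<lambda>x. u x * v x) \<in> elementary_smooth"
| inverse: "u \<in> elementary_smooth \<Longrightarrow> (\<And>x. u x \<noteq> 0) \<Longrightarrow> (\<lambda>x. inverse (u x)) \<in> elementary_smooth"
| flat: "u \<in> elementary_smooth \<Longrightarrow> (\<lambda>x. flat P (u x)) \<in> elementary_smooth"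

lemma elementary_smooth_diff:
  assumes "u \<in> elementary_smooth" "v \<in> elementary_smooth"
  shows "(\<lambda>x. u x - v x) \<in> elementary_smooth"
  using elementary_smooth.add[OF assms(1) elementary_smooth.mult[OF elementary_smooth.const[of "-1"] assms(2)]]
  by simp

lemma elementary_smooth_power:
  assumes "u \<in> elementary_smooth"
  shows "(\<lambda>x. u x ^ n) \<in> elementary_smooth"
  using assms by (induction n) (auto intro: elementary_smooth.intros)

lemma elementary_smooth_derivative:
  "u \<in> elementary_smooth \<Longrightarrow> \<exists>v\<in>elementary_smooth. \<forall>x. (u has_real_derivative v x) (at x)"
proof (induction rule: elementary_smooth.induct)
  case (const c)
  show ?case
    by (rule bexI[of _ "\<lambda>_. 0"]) (auto intro: elementary_smooth.intros)
next
  case ident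
  show ?case
    by (rule bexI[of _ "\<lambda>_. 1"]) (auto intro: elementary_smooth.intros)
next
  case (add u v)
  then obtain u' v' where "u' \<in> elementary_smooth" "\<And>x. (u has_real_derivative u' x) (at x)"
    and "v' \<in> elementary_smooth" "\<And>x. (v has_real_derivative v' x) (at x)"
    by blast
  then show ?case
    by (intro bexI[of _ "\<lambda>x. u' x + v' x"]) (auto intro: elementary_smooth.intros derivative_intros)
next
  case (mult u v)
  then obtain u' v' where "u' \<in> elementary_smooth" "\<And>x. (u has_real_derivative u' x) (at x)"
    and "v' \<in> elementary_smooth" "\<And>x. (v has_real_derivative v' x) (at x)"
    by blast
  with mult.hyps show ?case
    by (intro bexI[of _ "\<lambda>x. u' x * v x + v' x * u x"])
      (auto intro: elementary_smooth.intros DERIV_mult)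
next
  case (inverse u)
  then obtain u' where u': "u' \<in> elementary_smooth" "\<And>x. (u has_real_derivative u' x) (at x)"
    by blast
  \<comment> \<open>The sign is written as a constant factor, so that the closure rules for
    constants and products apply directly.\<close>
  have "(\<lambda>x. -1 * (u' x * (inverse (u x) * inverse (u x)))) \<in> elementary_smooth"
    by (intro elementary_smooth.intros u' inverse.hyps)
  moreover have "((\<lambda>x. inverse (u x)) has_real_derivative
      -1 * (u' x * (inverse (u x) * inverse (u x)))) (at x)" for x
    using DERIV_inverse_fun[OF u'(2) inverse.hyps(2)] by (simp add: algebra_simps)
  ultimately show ?case
    by (intro bexI[where x = "\<lambda>x. -1 * (u' x * (inverse (u x) * inverse (u x)))"]) auto
next
  case (flat u P)
  then obtain u' where u': "u' \<in> elementary_smooth" "\<And>x. (u has_real_derivative u' x) (at x)"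
    by blast
  have "(\<lambda>x. flat ([:0, 0, 1:] * (P - pderiv P)) (u x) * u' x) \<in> elementary_smooth"
    by (intro elementary_smooth.mult elementary_smooth.flat u' flat.hyps)
  moreover have "((\<lambda>x. flat P (u x)) has_real_derivative
      flat ([:0, 0, 1:] * (P - pderiv P)) (u x) * u' x) (at x)" for x
    by (rule DERIV_chain2[OF DERIV_flat u'(2)])
  ultimately show ?case
    by (intro bexI allI)
qed

lemma elementary_smooth_has_deriv:
  assumes "u \<in> elementary_smooth"
  shows "deriv u \<in> elementary_smooth" "(u has_real_derivative deriv u x) (at x)"
proof -
  obtain v where v: "v \<in> elementary_smooth" "\<And>x. (u has_real_derivative v x) (at x)"
    using elementary_smooth_derivative[OF assms] by blast
  then have "deriv u = v"
    by (auto intro: DERIV_imp_deriv)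
  with v show "deriv u \<in> elementary_smooth" "(u has_real_derivative deriv u x) (at x)"
    by auto
qed

lemma elementary_smooth_continuous:
  assumes "u \<in> elementary_smooth"
  shows "continuous_on A u"
  using elementary_smooth_has_deriv(2)[OF assms] by (meson DERIV_continuous_on DERIV_subset subset_UNIV)

text \<open>Iterated derivatives stay in the class by induction, and every member is differentiable
  and continuous.\<close>

lemma elementary_smooth_imp_Ck:
  assumes "u \<in> elementary_smooth"
  shows "Ck k u"
proof -
  have "(deriv ^^ i) u \<in> elementary_smooth" for i
    using assms by (induction i) (auto intro: elementary_smooth_has_deriv)
  then show ?thesis
    unfolding Ck_def
    by (meson elementary_smooth_continuous elementary_smooth_has_deriv(2) real_differentiable_def)
qed

section \<open>A smooth transition from 0 to 1\<close>

text \<open>The standard transition function built from \<open>exp (- (1 / x))\<close>. Since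
  \<open>x\<close> and \<open>1 - x\<close> cannot both be nonpositive, the denominator never
  vanishes.\<close>

definition smooth_step :: "real \<Rightarrow> real" where
  "smooth_step x = flat 1 x / (flat 1 x + flat 1 (1 - x))"

lemma smooth_step_denominator_pos: "flat 1 x + flat 1 (1 - x) > 0"
  by (auto simp: flat_def add_pos_pos)

lemma smooth_step_elementary: "u \<in> elementary_smooth \<Longrightarrow> (\<lambda>x. smooth_step (u x)) \<in> elementary_smooth"
  unfolding smooth_step_def divide_inverse using smooth_step_denominator_pos
  by (intro elementary_smooth.intros elementary_smooth_diff) (auto simp: less_imp_neq[symmetric])

lemma smooth_step_eq_0: "x \<le> 0 \<Longrightarrow> smooth_step x = 0"
  and smooth_step_eq_1: "x \<ge> 1 \<Longrightarrow> smooth_step x = 1"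
  by (simp_all add: smooth_step_def flat_def)

lemma smooth_step_bounds: "0 \<le> smooth_step x" "smooth_step x \<le> 1"
  using smooth_step_denominator_pos[of x] by (auto simp: smooth_step_def flat_def divide_simps)

lemma DERIV_smooth_step: "(smooth_step has_real_derivative deriv smooth_step x) (at x)"
  and continuous_deriv_smooth_step: "continuous_on A (deriv smooth_step)"
  using smooth_step_elementary[OF elementary_smooth.ident]
  by (auto intro: elementary_smooth_has_deriv elementary_smooth_continuous)

lemma deriv_smooth_step_eq_0:
  assumes "x \<notin> {0..1}"
  shows "deriv smooth_step x = 0"
proof -
  have "(smooth_step has_real_derivative 0) (at x)"
  proof (cases "x < 0")
    case True
    show ?thesis
      by (rule has_field_derivative_transform_within_open[where S = "{..<0}" and f = "\<lambda>_. 0"])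
        (use True in \<open>auto simp: smooth_step_eq_0\<close>)
  next
    case False
    show ?thesis
      by (rule has_field_derivative_transform_within_open[where S = "{1<..}" and f = "\<lambda>_. 1"])
        (use False assms in \<open>auto simp: smooth_step_eq_1\<close>)
  qed
  then show ?thesis
    by (rule DERIV_imp_deriv)
qed

text \<open>Total mass one is what lets the dilates of \<open>deriv smooth_step\<close> approximate
  a unit point mass.\<close>

lemma integral_deriv_smooth_step: "(LINT x|lebesgue. deriv smooth_step x) = 1"
proof -
  have "(LINT x|lebesgue. deriv smooth_step x) = (LINT x:{0..1}|lebesgue. deriv smooth_step x)"
    unfolding set_lebesgue_integral_def
    by (intro Bochner_Integration.integral_cong) (auto simp: indicator_def intro!: deriv_smooth_step_eq_0)
  also have "\<dots> = integral {0..1} (deriv smooth_step)"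
    by (intro set_lebesgue_integral_eq_integral absolutely_integrable_continuous_real
        continuous_deriv_smooth_step)
  also have "\<dots> = smooth_step 1 - smooth_step 0"
    by (intro integral_unique fundamental_theorem_of_calculus)
      (auto simp flip: has_real_derivative_iff_has_vector_derivative
        intro: DERIV_smooth_step DERIV_subset)
  finally show ?thesis
    by (simp add: smooth_step_eq_0 smooth_step_eq_1)
qed

section \<open>Cutoffs approximating half-open intervals\<close>

text \<open>Both transitions lie immediately to the right of their endpoint, so the limit loses
  \<open>a\<close> and keeps \<open>b\<close>, as in the half-open \<open>oriented_interval\<close>.
  The factor \<open>Suc n\<close> is at least 1 from \<open>n = 0\<close> on.\<close>

definition cutoff :: "real \<Rightarrow> real \<Rightarrow> nat \<Rightarrow> real \<Rightarrow> real" where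
  "cutoff a b n x = smooth_step (real (Suc n) * (x - a)) - smooth_step (real (Suc n) * (x - b))"

lemma cutoff_elementary: "cutoff a b n \<in> elementary_smooth"
  unfolding cutoff_def
  by (intro elementary_smooth_diff smooth_step_elementary elementary_smooth.intros)

lemma smooth_step_tendsto: "(\<lambda>n. smooth_step (real (Suc n) * x)) \<longlonglongrightarrow> indicator {0<..} x"
proof (cases "x > 0")
  case True
  \<comment> \<open>Once \<open>n\<close> exceeds \<open>1 / x\<close> the argument has passed 1, so
    the sequence is eventually constant.\<close>
  have "\<forall>\<^sub>F n in sequentially. 1 = smooth_step (real (Suc n) * x)"
    using eventually_ge_at_top[of "nat \<lceil>1 / x\<rceil>"]
  proof eventually_elim
    case (elim n)
    then have "1 / x \<le> real (Suc n)" by linarith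
    with True show ?case by (simp add: smooth_step_eq_1 field_simps)
  qed
  then show ?thesis
    using True by (auto intro: Lim_transform_eventually[OF tendsto_const])
next
  case False
  then show ?thesis
    by (simp add: smooth_step_eq_0 mult_nonneg_nonpos)
qed

lemma cutoff_tendsto:
  assumes "a \<le> b"
  shows "(\<lambda>n. cutoff a b n x) \<longlonglongrightarrow> indicator {a<..b} x"
proof -
  have "(\<lambda>n. cutoff a b n x) \<longlonglongrightarrow> indicator {0<..} (x - a) - indicator {0<..} (x - b)"
    unfolding cutoff_def by (intro tendsto_diff smooth_step_tendsto)
  also have "indicator {0<..} (x - a) - indicator {0<..} (x - b) = (indicator {a<..b} x :: real)"
    using assms by (auto simp: indicator_def)
  finally show ?thesis .
qed

text \<open>A transition has width \<open>1 / Suc n\<close>, hence at most 1, so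
  \<open>{a..b + 1}\<close> contains all supports. This uniformity in \<open>n\<close> is used for
  dominated convergence.\<close>

lemma abs_cutoff_le:
  assumes "a \<le> b"
  shows "\<bar>cutoff a b n x\<bar> \<le> indicator {a..b + 1} x"
proof (cases "x \<in> {a..b + 1}")
  case True
  then show ?thesis
    using smooth_step_bounds[of "real (Suc n) * (x - a)"] smooth_step_bounds[of "real (Suc n) * (x - b)"]
    by (simp add: cutoff_def abs_le_iff)
next
  case False
  then consider "x \<le> a" | "x \<ge> b + 1" by fastforce
  then have "cutoff a b n x = 0"
  proof cases
    case 1
    then show ?thesis
      using assms by (simp add: cutoff_def smooth_step_eq_0 mult_nonneg_nonpos)
  next
    case 2
    then have "1 * 1 \<le> real (Suc n) * (x - b)" "1 * 1 \<le> real (Suc n) * (x - a)"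
      using assms by (intro mult_mono; simp)+
    then show ?thesis
      by (simp add: cutoff_def smooth_step_eq_1 del: of_nat_Suc)
  qed
  then show ?thesis by simp
qed

lemma cutoff_times_test:
  assumes "a \<le> b" "w \<in> elementary_smooth"
  shows "(\<lambda>x. cutoff a b n x * w x) \<in> test_functions"
proof -
  have "(\<lambda>x. cutoff a b n x * w x) \<in> elementary_smooth"
    by (rule elementary_smooth.mult[OF cutoff_elementary assms(2)])
  moreover have "{x. cutoff a b n x * w x \<noteq> 0} \<subseteq> {a..b + 1}"
  proof
    fix x assume "x \<in> {x. cutoff a b n x * w x \<noteq> 0}"
    then show "x \<in> {a..b + 1}"
      using abs_cutoff_le[OF assms(1), of n x] by (cases "x \<in> {a..b + 1}") auto
  qed
  then have "compact (closure {x. cutoff a b n x * w x \<noteq> 0})"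
    unfolding compact_closure by (rule bounded_subset[OF bounded_closed_interval])
  ultimately show ?thesis
    unfolding test_functions_def by (blast intro: elementary_smooth_imp_Ck)
qed

lemma continuous_imp_locally_integrable:
  assumes "continuous_on UNIV h"
  shows "locally_integrable h"
  unfolding locally_integrable_def
proof safe
  fix K :: "real set" assume "compact K"
  then obtain a b where "K \<subseteq> {a..b}"
    using compact_imp_bounded bounded_subset_cbox_symmetric by (metis box_real(2))
  moreover have "set_integrable lebesgue {a..b} h"
    by (rule absolutely_integrable_continuous_real) (rule continuous_on_subset[OF assms], simp)
  ultimately show "set_integrable lebesgue K h"
    using \<open>compact K\<close> by (auto intro: set_integrable_subset simp: borel_compact)
qed

lemma continuous_bounded_on_interval:
  fixes w :: "real \<Rightarrow> real"
  assumes "continuous_on UNIV w"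
  obtains C where "C \<ge> 0" "\<And>x. x \<in> {a..b} \<Longrightarrow> \<bar>w x\<bar> \<le> C"
proof -
  have "bounded (w ` {a..b})"
    by (intro compact_imp_bounded compact_continuous_image continuous_on_subset[OF assms]) auto
  then obtain C where "C > 0" "\<forall>y\<in>w ` {a..b}. norm y \<le> C"
    unfolding bounded_pos by blast
  then show thesis
    using that[of C] by simp
qed

text \<open>Dominated convergence: \<open>w\<close> is bounded by some \<open>C\<close> on
  \<open>{a..b + 1}\<close>, and \<open>C\<close> times the truncation of
  \<open>\<bar>g x\<bar>\<close> to that interval is an integrable majorant for every
  \<open>n\<close>.\<close>

lemma cutoff_integral_tendsto:
  assumes ab: "a \<le> b" and g: "locally_integrable g" and w: "continuous_on UNIV w"
  shows "integrable lebesgue (\<lambda>x. g x * (cutoff a b n x * w x))"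
    and "set_integrable lebesgue {a<..b} (\<lambda>x. g x * w x)"
    and "(\<lambda>n. LINT x|lebesgue. g x * (cutoff a b n x * w x))
      \<longlonglongrightarrow> (LINT x:{a<..b}|lebesgue. g x * w x)"
proof -
  obtain C where C: "C \<ge> 0" "\<And>x. x \<in> {a..b + 1} \<Longrightarrow> \<bar>w x\<bar> \<le> C"
    using continuous_bounded_on_interval[OF w] by metis
  have gi: "integrable lebesgue (\<lambda>x. indicator {a..b + 1} x * g x)"
    using g by (auto simp: locally_integrable_def set_integrable_def)
  have wm [measurable]: "w \<in> borel_measurable lebesgue"
    using borel_measurable_continuous_onI[OF w] by (intro measurable_completion) simp
  have [measurable]: "cutoff a b n \<in> borel_measurable lebesgue" for n
    using borel_measurable_continuous_onI[OF elementary_smooth_continuous[OF cutoff_elementary]]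
    by (intro measurable_completion) simp
  \<comment> \<open>Local integrability speaks about truncations of \<open>g\<close> to compact
    sets. Inserting the indicator therefore exhibits the integrands as products of functions known
    to be measurable.\<close>
  have eq: "g x * (cutoff a b n x * w x) = (indicator {a..b + 1} x * g x) * (cutoff a b n x * w x)" for n x
    using abs_cutoff_le[OF ab, of n x] by (cases "x \<in> {a..b + 1}") auto
  have eq': "indicator {a<..b} x *\<^sub>R (g x * w x)
      = (indicator {a..b + 1} x * g x) * (indicator {a<..b} x * w x)" for x
    by (auto simp: indicator_def)
  have dom: "integrable lebesgue (\<lambda>x. C * \<bar>indicator {a..b + 1} x * g x\<bar>)"
    using gi by simp
  have lim: "AE x in lebesgue. (\<lambda>n. g x * (cutoff a b n x * w x))
      \<longlonglongrightarrow> indicator {a<..b} x *\<^sub>R (g x * w x)"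
    unfolding eq eq' by (intro AE_I2 tendsto_intros cutoff_tendsto ab)
  have bound: "AE x in lebesgue. norm (g x * (cutoff a b n x * w x)) \<le> C * \<bar>indicator {a..b + 1} x * g x\<bar>" for n
  proof (rule AE_I2)
    fix x
    have "\<bar>cutoff a b n x\<bar> * \<bar>w x\<bar> \<le> 1 * C" if "x \<in> {a..b + 1}"
      using that C abs_cutoff_le[OF ab, of n x] by (intro mult_mono) auto
    then have "\<bar>g x\<bar> * (\<bar>cutoff a b n x\<bar> * \<bar>w x\<bar>) \<le> \<bar>g x\<bar> * C" if "x \<in> {a..b + 1}"
      using that by (intro mult_left_mono) auto
    then show "norm (g x * (cutoff a b n x * w x)) \<le> C * \<bar>indicator {a..b + 1} x * g x\<bar>"
      unfolding eq by (auto simp: indicator_def abs_mult mult_ac)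
  qed
  have meas: "(\<lambda>x. g x * (cutoff a b n x * w x)) \<in> borel_measurable lebesgue" for n
    unfolding eq by (rule borel_measurable_times[OF borel_measurable_integrable[OF gi]]) auto
  have meas_lim: "(\<lambda>x. indicator {a<..b} x *\<^sub>R (g x * w x)) \<in> borel_measurable lebesgue"
    unfolding eq'
    by (rule borel_measurable_times[OF borel_measurable_integrable[OF gi]
        borel_measurable_times[OF borel_measurable_indicator wm]]) simp
  show "integrable lebesgue (\<lambda>x. g x * (cutoff a b n x * w x))"
    by (rule integrable_dominated_convergence2[OF meas_lim meas dom lim bound])
  show "set_integrable lebesgue {a<..b} (\<lambda>x. g x * w x)"
    unfolding set_integrable_def
    by (rule integrable_dominated_convergence[OF meas_lim meas dom lim bound])
  show "(\<lambda>n. LINT x|lebesgue. g x * (cutoff a b n x * w x))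
      \<longlonglongrightarrow> (LINT x:{a<..b}|lebesgue. g x * w x)"
    unfolding set_lebesgue_integral_def
    by (rule integral_dominated_convergence[OF meas_lim meas dom lim bound])
qed

section \<open>Taylor's formula with weak derivatives\<close>

text \<open>\<open>D n\<close> has mass one and shrinks to \<open>a\<close> from the right.
  Substitution moves the dependence on \<open>n\<close> into the argument of \<open>k\<close>, where
  continuity gives the limit.\<close>

lemma dilated_bump_integral_tendsto:
  fixes k :: "real \<Rightarrow> real" and a :: real
  assumes k: "continuous_on UNIV k"
  defines "D \<equiv> \<lambda>n x. real (Suc n) * deriv smooth_step (real (Suc n) * (x - a))"
  shows "integrable lebesgue (\<lambda>x. k x * D n x)"
    and "(\<lambda>n. LINT x|lebesgue. k x * D n x) \<longlonglongrightarrow> k a"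
proof -
  have D_outside: "D n x = 0" if "x \<notin> {a..a + 1}" for n x
  proof -
    have "real (Suc n) * (x - a) \<notin> {0..1}"
    proof (cases "x < a")
      case True
      then show ?thesis
        by (simp add: mult_pos_neg not_le del: of_nat_Suc)
    next
      case False
      with that have "1 < x - a" by auto
      then have "1 * 1 < real (Suc n) * (x - a)"
        by (intro mult_le_less_imp_less) auto
      then show ?thesis by simp
    qed
    then show ?thesis
      by (simp add: D_def deriv_smooth_step_eq_0 del: of_nat_Suc)
  qed
  have contD: "continuous_on A (D n)" for A n
    unfolding D_def
    by (intro continuous_intros continuous_on_compose2[OF continuous_deriv_smooth_step[of UNIV]]) auto
  have "integrable lebesgue (\<lambda>x. indicator {a..a + 1} x *\<^sub>R (k x * D n x))"
    using absolutely_integrable_continuous_real[of a "a + 1" "\<lambda>x. k x * D n x"]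
    by (auto simp: set_integrable_def intro!: continuous_intros contD continuous_on_subset[OF k])
  also have "(\<lambda>x. indicator {a..a + 1} x *\<^sub>R (k x * D n x)) = (\<lambda>x. k x * D n x)"
    using D_outside by (force simp: indicator_def)
  finally show "integrable lebesgue (\<lambda>x. k x * D n x)" .
  \<comment> \<open>Substituting \<open>x = a + y / Suc n\<close>, the Jacobian cancels the factor
    \<open>Suc n\<close> in \<open>D\<close>.\<close>
  have rescale: "(LINT x|lebesgue. k x * D n x)
      = (LINT y|lebesgue. k (a + y / real (Suc n)) * deriv smooth_step y)" for n
    using lebesgue_integral_real_affine[of "1 / real (Suc n)" "\<lambda>x. k x * D n x" a]
    by (simp add: D_def mult.left_commute[of _ "real (Suc n)"] del: of_nat_Suc)
  \<comment> \<open>For \<open>y\<close> in \<open>{0..1}\<close> all points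
    \<open>a + y / Suc n\<close> lie in this interval, so one \<open>C\<close> works for every
    \<open>n\<close>.\<close>
  obtain C where C: "C \<ge> 0" "\<And>x. x \<in> {a..a + 1} \<Longrightarrow> \<bar>k x\<bar> \<le> C"
    using continuous_bounded_on_interval[OF k] by metis
  have "(\<lambda>n. LINT y|lebesgue. k (a + y / real (Suc n)) * deriv smooth_step y)
      \<longlonglongrightarrow> (LINT y|lebesgue. k a * deriv smooth_step y)"
  proof (rule integral_dominated_convergence[where w = "\<lambda>y. C * \<bar>indicator {0..1} y *\<^sub>R deriv smooth_step y\<bar>"])
    have [measurable]: "deriv smooth_step \<in> borel_measurable lebesgue"
      using borel_measurable_continuous_onI[OF continuous_deriv_smooth_step]
      by (intro measurable_completion) simp
    show "(\<lambda>y. k a * deriv smooth_step y) \<in> borel_measurable lebesgue"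
      by measurable
    show "(\<lambda>y. k (a + y / real (Suc n)) * deriv smooth_step y) \<in> borel_measurable lebesgue" for n
    proof -
      have "continuous_on UNIV (\<lambda>y. k (a + y / real (Suc n)) * deriv smooth_step y)"
        by (intro continuous_intros continuous_on_compose2[OF k] continuous_deriv_smooth_step) auto
      from borel_measurable_continuous_onI[OF this] show ?thesis
        by (intro measurable_completion) simp
    qed
    have "set_integrable lebesgue {0..1} (deriv smooth_step)"
      by (intro absolutely_integrable_continuous_real continuous_deriv_smooth_step)
    then show "integrable lebesgue (\<lambda>y. C * \<bar>indicator {0..1} y *\<^sub>R deriv smooth_step y\<bar>)"
      by (intro integrable_mult_right integrable_abs) (simp add: set_integrable_def)
    have "(\<lambda>n. k (a + y / real (Suc n))) \<longlonglongrightarrow> k (a + 0)" for y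
    proof (rule continuous_on_tendsto_compose[OF k])
      show "(\<lambda>n. a + y / real (Suc n)) \<longlonglongrightarrow> a + 0"
        by (intro tendsto_intros LIMSEQ_Suc lim_const_over_n)
    qed auto
    then show "AE y in lebesgue. (\<lambda>n. k (a + y / real (Suc n)) * deriv smooth_step y)
        \<longlonglongrightarrow> k a * deriv smooth_step y"
      by (intro AE_I2 tendsto_intros) simp
    show "AE y in lebesgue. norm (k (a + y / real (Suc n)) * deriv smooth_step y)
        \<le> C * \<bar>indicator {0..1} y *\<^sub>R deriv smooth_step y\<bar>" for n
    proof (rule AE_I2)
      fix y :: real
      show "norm (k (a + y / real (Suc n)) * deriv smooth_step y)
        \<le> C * \<bar>indicator {0..1} y *\<^sub>R deriv smooth_step y\<bar>"
      proof (cases "y \<in> {0..1}")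
        case True
        then have "y / real (Suc n) \<le> 1" "0 \<le> y / real (Suc n)"
          by (auto simp: divide_le_eq)
        then show ?thesis
          using True C(2) by (auto simp: abs_mult intro!: mult_right_mono)
      next
        case False
        then show ?thesis by (simp add: deriv_smooth_step_eq_0)
      qed
    qed
  qed
  also have "(LINT y|lebesgue. k a * deriv smooth_step y) = k a"
    by (simp add: integral_deriv_smooth_step)
  finally show "(\<lambda>n. LINT x|lebesgue. k x * D n x) \<longlonglongrightarrow> k a"
    by (simp only: rescale)
qed

text \<open>The derivative of the cutoff converges to the difference of the point masses at \<open>a\<close>
  and \<open>b\<close>, which produces the boundary terms.\<close>

lemma weak_derivative_integration_by_parts:
  assumes weak: "has_weak_derivative h g" and h: "continuous_on UNIV h"
    and w: "w \<in> elementary_smooth" and "a \<le> b"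
  shows "h b * w b - h a * w a
    = (LINT x:{a<..b}|lebesgue. h x * deriv w x) + (LINT x:{a<..b}|lebesgue. g x * w x)"
proof -
  define D where "D c n x = real (Suc n) * deriv smooth_step (real (Suc n) * (x - c))" for c n x
  have g: "locally_integrable g" and h': "locally_integrable h"
    using weak by (auto simp: has_weak_derivative_def)
  have cw: "continuous_on UNIV w" and cw': "continuous_on UNIV (deriv w)"
    using w by (auto intro: elementary_smooth_continuous elementary_smooth_has_deriv)
  have hw: "continuous_on UNIV (\<lambda>x. h x * w x)"
    by (intro continuous_intros h cw)
  have deriv_eq: "deriv (\<lambda>x. cutoff a b n x * w x) x
      = (D a n x - D b n x) * w x + cutoff a b n x * deriv w x" for n x
    unfolding cutoff_def D_def
    by (rule DERIV_imp_deriv)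
      (auto intro!: derivative_eq_intros DERIV_chain2[OF DERIV_smooth_step]
        elementary_smooth_has_deriv(2)[OF w] simp: algebra_simps)
  \<comment> \<open>The weak derivative is tested against \<open>cutoff a b n x * w x\<close>.
    Splitting the integral in three relies on the integrability of each piece.\<close>
  have test: "(LINT x|lebesgue. h x * w x * D a n x) - (LINT x|lebesgue. h x * w x * D b n x)
      + (LINT x|lebesgue. h x * (cutoff a b n x * deriv w x))
      = - (LINT x|lebesgue. g x * (cutoff a b n x * w x))" for n
  proof -
    have "(LINT x|lebesgue. h x * deriv (\<lambda>x. cutoff a b n x * w x) x)
        = - (LINT x|lebesgue. g x * (cutoff a b n x * w x))"
      using weak cutoff_times_test[OF \<open>a \<le> b\<close> w] by (auto simp: has_weak_derivative_def)
    moreover have "(LINT x|lebesgue. h x * deriv (\<lambda>x. cutoff a b n x * w x) x)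
      = (LINT x|lebesgue. h x * w x * D a n x - h x * w x * D b n x
          + h x * (cutoff a b n x * deriv w x))"
      unfolding deriv_eq by (simp add: algebra_simps)
    ultimately show ?thesis
      using dilated_bump_integral_tendsto(1)[OF hw] cutoff_integral_tendsto(1)[OF \<open>a \<le> b\<close> h' cw']
      by (simp add: D_def del: of_nat_Suc)
  qed
  have "(\<lambda>n. (LINT x|lebesgue. h x * w x * D a n x) - (LINT x|lebesgue. h x * w x * D b n x)
      + (LINT x|lebesgue. h x * (cutoff a b n x * deriv w x)))
    \<longlonglongrightarrow> h a * w a - h b * w b + (LINT x:{a<..b}|lebesgue. h x * deriv w x)"
    unfolding D_def
    by (intro tendsto_intros dilated_bump_integral_tendsto(2)[OF hw]
        cutoff_integral_tendsto(3)[OF \<open>a \<le> b\<close> h' cw'])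
  moreover have "(\<lambda>n. - (LINT x|lebesgue. g x * (cutoff a b n x * w x)))
      \<longlonglongrightarrow> - (LINT x:{a<..b}|lebesgue. g x * w x)"
    by (intro tendsto_intros cutoff_integral_tendsto(3)[OF \<open>a \<le> b\<close> g cw])
  ultimately have "h a * w a - h b * w b + (LINT x:{a<..b}|lebesgue. h x * deriv w x)
      = - (LINT x:{a<..b}|lebesgue. g x * w x)"
    unfolding test by (rule LIMSEQ_unique)
  then show ?thesis by simp
qed

section \<open>Taylor polynomials as functions of their centre\<close>

lemma DERIV_reflected_power:
  "((\<lambda>x. (c - x) ^ Suc m) has_real_derivative - (real (Suc m) * (c - x) ^ m)) (at x)"
  by (rule derivative_eq_intros refl)+ simp

text \<open>The evaluation point \<open>c\<close> is fixed while the centre \<open>x\<close> moves.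
  Differentiating the power in one summand cancels the differentiated coefficient of the preceding
  one, so only the top term survives.\<close>

lemma DERIV_Taylor_sum_in_center:
  fixes f :: "real \<Rightarrow> real"
  assumes "\<And>i x. i \<le> m \<Longrightarrow> ((deriv ^^ i) f has_real_derivative (deriv ^^ Suc i) f x) (at x)"
  shows "((\<lambda>x. \<Sum>k\<le>m. (deriv ^^ k) f x / fact k * (c - x) ^ k) has_real_derivative
    (deriv ^^ Suc m) f x / fact m * (c - x) ^ m) (at x)"
  using assms
proof (induction m)
  case 0
  then show ?case by simp
next
  case (Suc m)
  have "((\<lambda>x. (deriv ^^ Suc m) f x / fact (Suc m) * (c - x) ^ Suc m) has_real_derivative
      (deriv ^^ Suc (Suc m)) f x / fact (Suc m) * (c - x) ^ Suc m
      - (deriv ^^ Suc m) f x / fact m * (c - x) ^ m) (at x)"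
  proof -
    have quot: "((\<lambda>x. (deriv ^^ Suc m) f x / fact (Suc m)) has_real_derivative
        (deriv ^^ Suc (Suc m)) f x / fact (Suc m)) (at x)"
      by (rule DERIV_cdivide) (rule Suc.prems, simp)
    have coeff: "- (real (Suc m) * (c - x) ^ m) * ((deriv ^^ Suc m) f x / fact (Suc m))
        = - ((deriv ^^ Suc m) f x / fact m * (c - x) ^ m)"
      by (simp add: fact_Suc del: funpow.simps of_nat_Suc)
    show ?thesis
      using DERIV_mult[OF quot DERIV_reflected_power[of c m x]] by (simp only: coeff add_uminus_conv_diff)
  qed
  moreover have "((\<lambda>x. \<Sum>k\<le>m. (deriv ^^ k) f x / fact k * (c - x) ^ k) has_real_derivative
    (deriv ^^ Suc m) f x / fact m * (c - x) ^ m) (at x)"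
    using Suc by simp
  ultimately show ?case
    using DERIV_add by (fastforce simp del: funpow.simps)
qed

text \<open>The terms below order \<open>m\<close> form a classically differentiable
  \<open>G\<close> with derivative \<open>- (h x * deriv w x)\<close>. The top term is
  \<open>h x * w x\<close>, treated by weak integration by parts, and the integrals of
  \<open>h x * deriv w x\<close> cancel. Keeping \<open>c\<close> free allows it to be either
  endpoint.\<close>

theorem Taylor_weak_remainder:
  fixes f g :: "real \<Rightarrow> real"
  assumes f: "Ck m f" and weak: "has_weak_derivative ((deriv ^^ m) f) g" and "a \<le> b"
  shows "(\<Sum>k\<le>m. (deriv ^^ k) f b / fact k * (c - b) ^ k)
      - (\<Sum>k\<le>m. (deriv ^^ k) f a / fact k * (c - a) ^ k)
    = 1 / fact m * (LINT x:{a<..b}|lebesgue. g x * (c - x) ^ m)"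
proof -
  define h where "h = (deriv ^^ m) f"
  define w where "w x = 1 / fact m * (c - x) ^ m" for x :: real
  define G where "G x = (\<Sum>k<m. (deriv ^^ k) f x / fact k * (c - x) ^ k)" for x
  have h: "continuous_on UNIV h"
    using f by (simp add: Ck_def h_def)
  have "w \<in> elementary_smooth"
    unfolding w_def by (intro elementary_smooth.intros elementary_smooth_power elementary_smooth_diff)
  note w = this elementary_smooth_has_deriv[OF this]
  have G: "(G has_real_derivative - (h x * deriv w x)) (at x)" for x
  proof (cases m)
    case 0
    \<comment> \<open>For \<open>m = 0\<close> the sum \<open>G\<close> is empty and
      \<open>w\<close> is constant, so both sides are 0.\<close>
    then have "w = (\<lambda>_. 1)"
      by (auto simp: w_def)
    then have "deriv w x = 0" by simp
    then show ?thesis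
      using 0 by (simp add: G_def[abs_def])
  next
    case (Suc l)
    have "deriv w x = 1 / fact (Suc l) * - (real (Suc l) * (c - x) ^ l)"
      unfolding w_def Suc by (intro DERIV_imp_deriv DERIV_cmult DERIV_reflected_power)
    then have "deriv w x = - ((c - x) ^ l / fact l)"
      by (simp add: fact_Suc del: of_nat_Suc)
    moreover have "((deriv ^^ i) f has_real_derivative (deriv ^^ Suc i) f y) (at y)" if "i \<le> l" for i y
      using f that Suc by (auto simp: Ck_def DERIV_deriv_iff_real_differentiable)
    from DERIV_Taylor_sum_in_center[OF this, where c = c and x = x]
    have "(G has_real_derivative h x / fact l * (c - x) ^ l) (at x)"
      by (simp add: G_def[abs_def] h_def Suc lessThan_Suc_atMost)
    ultimately show ?thesis by simp
  qed
  have "set_integrable lebesgue {a..b} (\<lambda>x. h x * deriv w x)"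
    by (intro absolutely_integrable_continuous_real continuous_intros
        continuous_on_subset[OF h] elementary_smooth_continuous w) auto
  then have "(LINT x:{a..b}|lebesgue. h x * deriv w x) = integral {a..b} (\<lambda>x. h x * deriv w x)"
    by (rule set_lebesgue_integral_eq_integral)
  also have "\<dots> = - G b - (- G a)"
    using \<open>a \<le> b\<close> DERIV_minus[OF G]
    by (intro integral_unique fundamental_theorem_of_calculus)
      (auto simp flip: has_real_derivative_iff_has_vector_derivative intro: DERIV_subset)
  also have "(LINT x:{a..b}|lebesgue. h x * deriv w x) = (LINT x:{a<..b}|lebesgue. h x * deriv w x)"
    \<comment> \<open>The closed and the half-open interval differ only in the null set
      \<open>{a}\<close>.\<close>
    unfolding set_lebesgue_integral_def
    by (rule integral_discrete_difference[of "{a}"]) (auto simp: indicator_def)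
  finally have int: "(LINT x:{a<..b}|lebesgue. h x * deriv w x) = G a - G b" by simp
  have split: "(\<Sum>k\<le>m. (deriv ^^ k) f x / fact k * (c - x) ^ k) = G x + h x * w x" for x
    by (simp add: G_def h_def w_def lessThan_Suc_atMost[symmetric])
  have "1 / fact m * (LINT x:{a<..b}|lebesgue. g x * (c - x) ^ m) = (LINT x:{a<..b}|lebesgue. g x * w x)"
    by (simp add: w_def flip: set_integral_mult_right)
  then show ?thesis
    using weak_derivative_integration_by_parts[OF weak[folded h_def] h w(1) \<open>a \<le> b\<close>]
    unfolding split int by simp
qed

section \<open>Change of variable\<close>

text \<open>Taylor's formula is evaluated at \<open>c = b\<close> in both orientations. If
  \<open>b < a\<close>, exchanging the endpoints reverses the sign of the integral, and odd
  \<open>m\<close> supplies the same sign in \<open>\<bar>b - x\<bar> ^ m = - ((b - x) ^ m)\<close>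
  for \<open>x > b\<close>.\<close>

lemma oriented_Taylor_remainder:
  fixes f g :: "real \<Rightarrow> real"
  assumes "odd m" and f: "Ck m f" and weak: "has_weak_derivative ((deriv ^^ m) f) g"
  defines "K \<equiv> \<lambda>a b x. indicator (oriented_interval a b) x * \<bar>b - x\<bar> ^ m"
  shows "integrable lebesgue (\<lambda>x. g x * K a b x)"
    and "f b - f a = (\<Sum>k=1..m. (deriv ^^ k) f a / fact k * (b - a) ^ k)
      + 1 / fact m * (LINT x|lebesgue. g x * K a b x)"
proof -
  have "{..m} = insert 0 {1..m}" by auto
  then have center: "(\<Sum>k\<le>m. (deriv ^^ k) f a / fact k * (b - a) ^ k)
      = f a + (\<Sum>k=1..m. (deriv ^^ k) f a / fact k * (b - a) ^ k)"
    by simp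
  \<comment> \<open>Centred at its own evaluation point, the polynomial keeps only the term
    \<open>k = 0\<close>, where \<open>0 ^ 0 = 1\<close>.\<close>
  have at_b: "(\<Sum>k\<le>m. (deriv ^^ k) f b / fact k * (b - b) ^ k) = f b"
    by (simp add: power_0_left if_distrib cong: if_cong)
  have int: "set_integrable lebesgue {u<..v} (\<lambda>x. g x * (b - x) ^ m)" if "u \<le> v" for u v
    using that weak
    by (intro cutoff_integral_tendsto(2)) (auto simp: has_weak_derivative_def intro!: continuous_intros)
  have "integrable lebesgue (\<lambda>x. g x * K a b x) \<and>
    f b - f a = (\<Sum>k=1..m. (deriv ^^ k) f a / fact k * (b - a) ^ k)
      + 1 / fact m * (LINT x|lebesgue. g x * K a b x)"
  proof (cases "a \<le> b")
    case True
    then have K: "g x * K a b x = indicator {a<..b} x *\<^sub>R (g x * (b - x) ^ m)" for x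
      by (auto simp: K_def oriented_interval_def indicator_def)
    show ?thesis
      unfolding K using int[OF True] Taylor_weak_remainder[OF f weak True, of b] center at_b
      by (simp add: set_integrable_def set_lebesgue_integral_def)
  next
    case False
    then have K: "g x * K a b x = - (indicator {b<..a} x *\<^sub>R (g x * (b - x) ^ m))" for x
      using power_minus_odd[OF \<open>odd m\<close>, of "b - x"]
      by (auto simp: K_def oriented_interval_def indicator_def)
    show ?thesis
      unfolding K using False int[of b a] Taylor_weak_remainder[OF f weak, of b a b] center at_b
      by (simp add: set_integrable_def set_lebesgue_integral_def)
  qed
  then show "integrable lebesgue (\<lambda>x. g x * K a b x)"
    and "f b - f a = (\<Sum>k=1..m. (deriv ^^ k) f a / fact k * (b - a) ^ k)
      + 1 / fact m * (LINT x|lebesgue. g x * K a b x)"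
    by auto
qed

text \<open>The one-step formula is summed over consecutive values \<open>X j\<close> of the path
  stopped at \<open>t\<close>; the left-hand sides telescope from \<open>S 0\<close> to
  \<open>S t\<close>.\<close>

lemma discrete_change_of_variable:
  fixes f g S :: "real \<Rightarrow> real"
  assumes P: "is_partition T P" and t: "t \<in> {0..T}"
    and "odd (p - 1)" and f: "Ck (p - 1) f" and weak: "has_weak_derivative ((deriv ^^ (p - 1)) f) g"
  shows "f (S t) - f (S 0) = compensated_sum P p f S t
    + 1 / fact (p - 1) * (LINT x|lebesgue. g x * discrete_local_time P (p - 1) S t x)"
proof -
  define X where "X j = S (min (P ! j) t)" for j
  define K where "K j x = indicator (oriented_interval (X j) (X (Suc j))) x * \<bar>X (Suc j) - x\<bar> ^ (p - 1)"
    for j x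
  note remainder = oriented_Taylor_remainder[OF \<open>odd (p - 1)\<close> f weak]
  have endpoints: "P ! 0 = 0" "P ! (length P - 1) = T"
    using P by (auto simp: is_partition_def hd_conv_nth last_conv_nth)
  \<comment> \<open>The compensated sum takes derivatives at \<open>S (P ! j)\<close> rather than at
    the stopped value. The two differ only when \<open>P ! j > t\<close>; then the increment is 0,
    and since \<open>k\<close> starts at 1 both sums vanish.\<close>
  have comp: "(\<Sum>k=1..p - 1. (deriv ^^ k) f (S (P ! j)) / fact k * (X (Suc j) - X j) ^ k)
      = (\<Sum>k=1..p - 1. (deriv ^^ k) f (X j) / fact k * (X (Suc j) - X j) ^ k)"
    if "j < length P - 1" for j
  proof (cases "P ! j \<le> t")
    case True
    then show ?thesis by (simp add: X_def)
  next
    case False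
    moreover have "P ! j < P ! Suc j"
      using P that by (auto simp: is_partition_def intro: sorted_wrt_nth_less)
    ultimately have "X (Suc j) = X j" by (simp add: X_def)
    then show ?thesis by simp
  qed
  have "f (S t) - f (S 0) = f (X (length P - 1)) - f (X 0)"
    using endpoints t by (simp add: X_def)
  also have "\<dots> = (\<Sum>j<length P - 1. f (X (Suc j)) - f (X j))"
    by (rule sum_lessThan_telescope[symmetric])
  also have "\<dots> = (\<Sum>j<length P - 1.
      (\<Sum>k=1..p - 1. (deriv ^^ k) f (S (P ! j)) / fact k * (X (Suc j) - X j) ^ k)
      + 1 / fact (p - 1) * (LINT x|lebesgue. g x * K j x))"
    unfolding K_def by (intro sum.cong refl) (simp only: comp remainder(2) lessThan_iff)
  also have "\<dots> = compensated_sum P p f S t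
      + 1 / fact (p - 1) * (\<Sum>j<length P - 1. LINT x|lebesgue. g x * K j x)"
    by (simp add: sum.distrib compensated_sum_def X_def sum_distrib_left)
  also have "(\<Sum>j<length P - 1. LINT x|lebesgue. g x * K j x)
      = (LINT x|lebesgue. (\<Sum>j<length P - 1. g x * K j x))"
    using remainder(1) by (simp add: K_def)
  also have "\<dots> = (LINT x|lebesgue. g x * discrete_local_time P (p - 1) S t x)"
    unfolding discrete_local_time_def K_def X_def by (simp only: sum_distrib_left)
  finally show ?thesis .
qed

theorem theorem3p2:
  fixes T t :: real and p :: nat and q :: ennreal
    and \<pi> :: "nat \<Rightarrow> real list"
    and f fp S :: "real \<Rightarrow> real" and L :: "real \<Rightarrow> real \<Rightarrow> real"
  assumes "T > 0"
    and "p \<ge> 2" and "even p"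
    and "q \<ge> 1"
    and "\<And>n. n \<ge> 1 \<Longrightarrow> is_partition T (\<pi> n)"
    and "Ck (p - 1) f"
    and "has_weak_derivative ((deriv ^^ (p - 1)) f) fp"
    and "fp \<in> Lq_space (conjugate_exponent q)"
    and "has_local_time T \<pi> q p S L"
    and "t \<in> {0..T}"
  shows "convergent (\<lambda>n. compensated_sum (\<pi> n) p f S t) \<and>
    integrable lebesgue (\<lambda>x. fp x * L t x) \<and>
    f (S t) - f (S 0) = pathwise_integral \<pi> p f S t
      + 1 / fact (p - 1) * (\<integral>x. fp x * L t x \<partial>lebesgue)"
proof -
  let ?D = "\<lambda>n. LINT x|lebesgue. fp x * discrete_local_time (\<pi> n) (p - 1) S t x"
  \<comment> \<open>\<open>R\<close> is the change of variable formula solved for the pathwise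
    integral, hence the only possible limit.\<close>
  define R where "R = f (S t) - f (S 0) - 1 / fact (p - 1) * (LINT x|lebesgue. fp x * L t x)"
  have weakly: "Lq_weakly_converges q (\<lambda>n. discrete_local_time (\<pi> n) (p - 1) S t) (L t)"
    using assms by (simp add: has_local_time_def)
  then have int: "integrable lebesgue (\<lambda>x. fp x * L t x)"
    using Hoelder_Lq(1) assms by (simp add: Lq_weakly_converges_def)
  have "?D \<longlonglongrightarrow> (LINT x|lebesgue. fp x * L t x)"
    using weakly integral_pairing_in_Lq_dual[of q fp] assms
    by (auto simp: Lq_weakly_converges_def)
  then have "(\<lambda>n. f (S t) - f (S 0) - 1 / fact (p - 1) * ?D n) \<longlonglongrightarrow> R"
    unfolding R_def by (intro tendsto_intros)
  \<comment> \<open>\<open>\<pi> n\<close> is assumed to be a partition only for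
    \<open>n \<ge> 1\<close>, so the discrete identity is claimed eventually.\<close>
  moreover have "\<forall>\<^sub>F n in sequentially.
      f (S t) - f (S 0) - 1 / fact (p - 1) * ?D n = compensated_sum (\<pi> n) p f S t"
    using eventually_ge_at_top[of 1]
  proof eventually_elim
    case (elim n)
    \<comment> \<open>The bound \<open>p \<ge> 2\<close> excludes \<open>p = 0\<close>, where
      truncated subtraction would give the even number 0.\<close>
    have "odd (p - 1)"
      using \<open>p \<ge> 2\<close> \<open>even p\<close> by simp
    from discrete_change_of_variable[OF assms(5)[OF elim] \<open>t \<in> {0..T}\<close> this assms(6,7), of S]
    show ?case by linarith
  qed
  ultimately have lim: "(\<lambda>n. compensated_sum (\<pi> n) p f S t) \<longlonglongrightarrow> R"
    by (rule Lim_transform_eventually)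
  then have "pathwise_integral \<pi> p f S t = R"
    unfolding pathwise_integral_def by (rule limI)
  with lim int show ?thesis
    by (auto simp: R_def convergent_def)
qed

end
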